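(* Let $k$ be a field of characteristic $0$ and $a\in k$. Let $K=k((v))((z))$ be the two-dimensional local skew field with relation $zvz^{-1}=v+z+a v^{-1}z^2$, and put $x=-v$. Let $$L=z^{-1}+u_1z+u_2z^2+u_3z^3+\cdots\ \in\ z^{-1}+K_-\otimes_k k[[t_1,t_2,\ldots]]$$ be a solution of the hierarchy $\dfrac{\partial L}{\partial t_n}=[(L^n)_+,L]$, $n\ge1$. Write $u=u_1$, $y=t_2$, $t=t_3$, and let $'$ denote the derivative with respect to $x$ and subscripts $y,t$ partial derivatives. Then $u$ satisfies the KP-type equation $$(4u_t-u'''-12uu')'=3u_{yy}+6a\left(2x^{-2}u''-x^{-2}u_y-x^{-1}u'''+x^{-1}u'_y-2x^{-3}u'\right).$$
   Context: $K=k((v))((z))$ denotes the skew field whose elements are uniquely written as $\sum_{i\ge N}c_iz^i$, $c_i\in k((v))$ (coefficients on the left), with $k$ central and multiplication continuous and determined by $zvz^{-1}=v+z+av^{-1}z^2$. (For $a=0$ this is the skew field of pseudo-differential operators $k((x))((\partial^{-1}))$ with $x=-v$, $\partial=z^{-1}$.) There is a decomposition $K=K_+\oplus K_-$, where $K_-$ consists of the elements containing only positive powers of $z$ and $K_+$ of the elements containing only nonpositive powers of $z$. For $M\in K$ the component in $K_+$ is denoted $M_+$. These operations are extended linearly to $K\otimes_k k[[t_1,t_2,\ldots]]$, where the variables $t_m$ are central and $\partial/\partial t_n$ acts coefficientwise. The coefficients $u_m=u_m(x,t_1,t_2,\ldots)$ of $L$ are elements of $k((v))\otimes_k k[[t_1,t_2,\ldots]]$.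 *)

theory Defs
  imports "HOL-Computational_Algebra.Formal_Laurent_Series" "HOL-Library.Poly_Mapping"
    "HOL-Analysis.Abstract_Topology"
begin

unbundle fps_syntax

text \<open>
  Elements of \<open>K = k((v))((z))\<close> are represented by their coefficient sequences, i.e. by the type
  \<^typ>\<open>'a fls fls\<close>, where \<open>M $$ i\<close> is the (left) coefficient of \<open>z\<^sup>i\<close>, an element of \<open>k((v))\<close>.
  Only the additive group and 1 of this type are those of \<open>K\<close>; the library product on it, for which
  \<open>z\<close> and \<open>v\<close> commute, merely serves below to write down series with prescribed coefficients.
\<close>

abbreviation z_K :: "'a::field fls fls" where "z_K \<equiv> fls_X"
abbreviation z_inv_K :: "'a::field fls fls" where "z_inv_K \<equiv> fls_X_inv"
abbreviation k_to_K :: "'a::field \<Rightarrow> 'a fls fls" where "k_to_K c \<equiv> fls_const (fls_const c)"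

text \<open>
  The usual topology of a two-dimensional local field: neighbourhoods of 0 are the sets of all
  \<open>\<Sum> c\<^sub>i z\<^sup>i\<close> with \<open>c\<^sub>i \<in> U\<^sub>i\<close>, where each \<open>U\<^sub>i\<close> is a neighbourhood of 0 in \<open>k((v))\<close> (with its
  \<open>v\<close>-adic topology, the library topology of \<^typ>\<open>'a fls\<close>) and \<open>U\<^sub>i = k((v))\<close> for all large \<open>i\<close>.
\<close>

definition topology_K :: "'a::field fls fls topology" where
  "topology_K = topology_generated_by
     {{M. \<forall>i. M $$ i \<in> U i} |U n. (\<forall>i. open (U i)) \<and> (\<forall>i\<ge>(n::int). U i = UNIV)}"

text \<open>
  As for commutative two-dimensional local fields, multiplication is continuous in each argument
  separately (it is not jointly continuous for this topology).
\<close>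

locale local_skew_field =
  fixes a :: "'a::field"
    and mul :: "'a fls fls \<Rightarrow> 'a fls fls \<Rightarrow> 'a fls fls"  (infixl "\<star>" 70)
  assumes ring_1: "class.ring_1 1 (\<star>) (+) 0 (-) uminus"
    and inverse_exists: "M \<noteq> 0 \<Longrightarrow> \<exists>N. M \<star> N = 1 \<and> N \<star> M = 1"
    and valuation_mul:
      "M \<noteq> 0 \<Longrightarrow> N \<noteq> 0 \<Longrightarrow> fls_subdegree (M \<star> N) = fls_subdegree M + fls_subdegree N"
    and coeff_left: "fls_const f \<star> M = fls_const f * M"
    and z_right: "M \<star> z_K = M * z_K"
    and central: "k_to_K c \<star> M = M \<star> k_to_K c"
    and continuous_left: "continuous_map topology_K topology_K (\<lambda>N. M \<star> N)"
    and continuous_right: "continuous_map topology_K topology_K (\<lambda>N. N \<star> M)"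
    and relation:
      "z_K \<star> fls_const fls_X \<star> z_inv_K
         = fls_const fls_X + z_K + fls_const (fls_const a * fls_X_inv) * z_K ^ 2"

definition K_plus :: "'a::field fls fls set" where
  "K_plus = {M. \<forall>i>0. M $$ i = 0}"

definition K_minus :: "'a::field fls fls set" where
  "K_minus = {M. \<forall>i\<le>0. M $$ i = 0}"

definition plus_part :: "'a::field fls fls \<Rightarrow> 'a fls fls" where
  "plus_part M = Abs_fls (\<lambda>i. if i \<le> 0 then M $$ i else 0)"

lemma nth_plus_part: "plus_part M $$ i = (if i \<le> 0 then M $$ i else 0)"
proof -
  have "\<forall>\<^sub>\<infinity>n::nat. (if - int n \<le> 0 then M $$ (- int n) else 0) = 0"
    using MOST_fls_neg_nth_eq_0[of M] by (rule MOST_mono) simp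
  thus ?thesis by (simp add: plus_part_def)
qed

lemma plus_part_decomposition: "plus_part M \<in> K_plus" "M - plus_part M \<in> K_minus"
  by (auto simp: K_plus_def K_minus_def nth_plus_part)

lemma K_plus_Int_K_minus: "(K_plus :: 'a::field fls fls set) \<inter> K_minus = {0}"
proof (intro equalityI subsetI)
  fix M :: "'a fls fls" assume "M \<in> K_plus \<inter> K_minus"
  hence "M $$ i = 0" for i by (cases "i > 0") (auto simp: K_plus_def K_minus_def)
  thus "M \<in> {0}" by (simp add: fls_eq_iff)
qed (auto simp: K_plus_def K_minus_def)

text \<open>
  A monomial \<open>\<Prod> t\<^sub>m\<^bsup>e\<^sub>m\<^esup>\<close> in \<open>t\<^sub>1, t\<^sub>2, \<dots>\<close> is given by its finitely supported exponent sequence;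
  the index \<open>i\<close> of the sequence belongs to the variable \<open>t\<^bsub>i+1\<^esub>\<close>. A power series in the \<open>t\<^sub>m\<close> with
  coefficients in \<open>'c\<close> is a function from monomials to \<open>'c\<close>. The canonical map
  \<open>K \<otimes>\<^sub>k k[[t\<^sub>1, t\<^sub>2, \<dots>]] \<rightarrow> K[[t\<^sub>1, t\<^sub>2, \<dots>]]\<close> is injective, so the (algebraic) tensor product is
  identified with its image, the finite sums \<open>\<Sum> M\<^sub>j h\<^sub>j\<close> with \<open>M\<^sub>j \<in> K\<close> and \<open>h\<^sub>j \<in> k[[t\<^sub>1, t\<^sub>2, \<dots>]]\<close>.
\<close>

type_synonym tmon = "nat \<Rightarrow>\<^sub>0 nat"
type_synonym 'c tseries = "tmon \<Rightarrow> 'c"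

definition tensor_series :: "'a::field fls fls set \<Rightarrow> 'a fls fls tseries set" where
  "tensor_series V =
     {F. \<exists>(r::nat) (M :: nat \<Rightarrow> 'a fls fls) (h :: nat \<Rightarrow> 'a tseries).
           (\<forall>j<r. M j \<in> V) \<and> F = (\<lambda>\<alpha>. \<Sum>j<r. k_to_K (h j \<alpha>) * M j)}"

definition t_const :: "'c::zero \<Rightarrow> 'c tseries" where
  "t_const c = (\<lambda>\<alpha>. if \<alpha> = 0 then c else 0)"

lemma finite_tmon_decompositions: "finite {(\<beta>, \<gamma>). \<beta> + \<gamma> = (\<alpha>::tmon)}"
proof -
  let ?B = "{\<beta>::tmon. \<exists>\<gamma>. \<beta> + \<gamma> = \<alpha>}"
  let ?S = "{f. \<forall>i. (i \<in> Poly_Mapping.keys \<alpha> \<longrightarrow> f i \<in> {..sum (Poly_Mapping.lookup \<alpha>) (Poly_Mapping.keys \<alpha>)})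
                     \<and> (i \<notin> Poly_Mapping.keys \<alpha> \<longrightarrow> f i = (0::nat))}"
  have "Poly_Mapping.lookup ` ?B \<subseteq> ?S"
  proof (intro subsetI)
    fix f assume "f \<in> Poly_Mapping.lookup ` ?B"
    then obtain \<beta> \<gamma> :: tmon where f: "f = Poly_Mapping.lookup \<beta>" and eq: "\<beta> + \<gamma> = \<alpha>" by blast
    have le: "f i \<le> Poly_Mapping.lookup \<alpha> i" for i
      unfolding f eq[symmetric] by (simp add: lookup_add)
    moreover have "Poly_Mapping.lookup \<alpha> i \<le> sum (Poly_Mapping.lookup \<alpha>) (Poly_Mapping.keys \<alpha>)"
      if "i \<in> Poly_Mapping.keys \<alpha>" for i
      using that by (intro member_le_sum) auto
    ultimately show "f \<in> ?S"
      by (auto simp: in_keys_iff intro: order_trans) (metis le_zero_eq)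
  qed
  moreover have "finite ?S" by (rule finite_set_of_finite_funs) auto
  ultimately have "finite (Poly_Mapping.lookup ` ?B)" by (rule finite_subset)
  hence fB: "finite ?B"
    by (rule finite_imageD) (auto intro!: inj_onI poly_mapping_eqI)
  have "{(\<beta>, \<gamma>). \<beta> + \<gamma> = \<alpha>} \<subseteq> ?B \<times> ?B"
    by (auto intro: exI[of _ "_ :: tmon"]) (metis add.commute)
  thus ?thesis using fB finite_subset by blast
qed

definition t_mult :: "('c \<Rightarrow> 'c \<Rightarrow> 'c) \<Rightarrow> 'c tseries \<Rightarrow> 'c tseries \<Rightarrow> 'c::comm_monoid_add tseries" where
  "t_mult mul F G = (\<lambda>\<alpha>. \<Sum>(\<beta>, \<gamma>) \<in> {(\<beta>, \<gamma>). \<beta> + \<gamma> = \<alpha>}. mul (F \<beta>) (G \<gamma>))"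

primrec t_pow :: "('c \<Rightarrow> 'c \<Rightarrow> 'c) \<Rightarrow> 'c tseries \<Rightarrow> nat \<Rightarrow> 'c::{comm_monoid_add, one} tseries" where
  "t_pow mul F 0 = t_const 1"
| "t_pow mul F (Suc n) = t_mult mul (t_pow mul F n) F"

definition t_commutator :: "('c \<Rightarrow> 'c \<Rightarrow> 'c) \<Rightarrow> 'c tseries \<Rightarrow> 'c tseries \<Rightarrow> 'c::ab_group_add tseries" where
  "t_commutator mul F G = (\<lambda>\<alpha>. t_mult mul F G \<alpha> - t_mult mul G F \<alpha>)"

definition t_plus_part :: "'a::field fls fls tseries \<Rightarrow> 'a fls fls tseries" where
  "t_plus_part F = (\<lambda>\<alpha>. plus_part (F \<alpha>))"

text \<open>\<open>t_deriv n\<close> is \<open>\<partial>/\<partial>t\<^sub>n\<close> and is only meant for \<open>n \<ge> 1\<close>.\<close>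

definition t_deriv :: "nat \<Rightarrow> 'c::semiring_1 tseries \<Rightarrow> 'c tseries" where
  "t_deriv n F = (\<lambda>\<alpha>. of_nat (Poly_Mapping.lookup \<alpha> (n - 1) + 1)
                        * F (\<alpha> + Poly_Mapping.single (n - 1) 1))"

definition KP_hierarchy ::
  "('a::field fls fls \<Rightarrow> 'a fls fls \<Rightarrow> 'a fls fls) \<Rightarrow> 'a fls fls tseries \<Rightarrow> bool" where
  "KP_hierarchy mul L \<longleftrightarrow>
     (\<forall>n\<ge>1. t_deriv n L = t_commutator mul (t_plus_part (t_pow mul L n)) L)"

text \<open>Since \<open>x = -v\<close>, the derivative with respect to \<open>x\<close> is minus the derivative with respect to \<open>v\<close>.\<close>

definition x_var :: "'a::field fls" where
  "x_var = - fls_X"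

definition x_deriv :: "'a::field fls tseries \<Rightarrow> 'a fls tseries" where
  "x_deriv F = (\<lambda>\<alpha>. - fls_deriv (F \<alpha>))"

end

theory Submission
  imports Defs
begin

text \<open>
  For \<open>f \<in> k((v))\<close> write \<open>z\<^sup>i f = \<Sum>\<^sub>k s\<^sub>i\<^sub>k(f) z\<^bsup>i+k\<^esup>\<close>. Associativity gives Leibniz rules for \<open>s\<^sub>1\<^sub>1\<close> and
  \<open>s\<^sub>1\<^sub>2\<close>; since they are continuous and their values at \<open>v\<close> are prescribed by the relation,
  \<open>s\<^sub>1\<^sub>1 = D := d/dv\<close> and \<open>s\<^sub>1\<^sub>2 = D\<^sup>2 + a v\<^bsup>-1\<^esup> D\<close>, so that for \<open>\<rho>\<^sub>k := s\<^bsub>-1,k\<^esub>\<close> one gets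
  \<open>\<rho>\<^sub>1 = -D = d/dx\<close> and \<open>\<rho>\<^sub>2 = -a v\<^bsup>-1\<^esup> D\<close>. Comparing the coefficients of \<open>z\<close> and \<open>z\<^sup>2\<close> in the
  \<open>t\<^sub>2\<close>-flow and of \<open>z\<close> in the \<open>t\<^sub>3\<close>-flow gives
  \<open>u\<^sub>y = u'' + 2 u\<^sub>2'\<close>,
  \<open>u\<^bsub>2,y\<^esub> = (\<rho>\<^sub>1 \<rho>\<^sub>2 + \<rho>\<^sub>2 \<rho>\<^sub>1) u + u\<^sub>2'' + 2 \<rho>\<^sub>2 u\<^sub>2 + 2 u\<^sub>3' + 2 u u'\<close> and
  \<open>u\<^sub>t = 3 \<rho>\<^sub>1 \<rho>\<^sub>2 u + u''' + 3 u\<^sub>2'' + 3 u\<^sub>3' + 6 u u'\<close>; the unknown operator \<open>\<rho>\<^sub>3\<close> cancels.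
  Eliminating \<open>u\<^sub>3\<close> and, after one more \<open>x\<close>-derivative, \<open>u\<^sub>2\<close> yields the equation.
\<close>

section \<open>Truncation of Laurent series and the topologies of k((v)) and K\<close>

text \<open>Order at least \<open>p\<close>, phrased so that 0 qualifies for every \<open>p\<close>,
  whereas \<open>fls_subdegree 0 = 0\<close>. It serves for series in v and in z alike.\<close>

definition vanish_below :: "int \<Rightarrow> 'a::zero fls \<Rightarrow> bool" where
  "vanish_below p M \<longleftrightarrow> (\<forall>i<p. M $$ i = 0)"

lemma vanish_below_ex: "\<exists>p. vanish_below p M"
  by (auto simp: vanish_below_def intro!: exI[of _ "fls_subdegree M"])

lemma fls_monomial_nth:
  "(fls_const c * fls_X_intpow i) $$ j = (if j = i then c else 0 :: 'a::comm_ring_1)"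
  by simp

text \<open>Replaces an infinite expansion by a finite sum, to which additivity applies, and a tail
  controlled by its order.\<close>

lemma fls_split_at:
  fixes M :: "'a::comm_ring_1 fls"
  assumes "vanish_below p M"
  obtains R where "M = (\<Sum>i\<in>{p..<q}. fls_const (M $$ i) * fls_X_intpow i) + R"
    "vanish_below q R"
proof
  let ?S = "\<Sum>i\<in>{p..<q}. fls_const (M $$ i) * fls_X_intpow i"
  show "M = ?S + (M - ?S)" by simp
  have "?S $$ j = (if p \<le> j \<and> j < q then M $$ j else 0)" for j
    unfolding fls_nth_sum fls_monomial_nth by (simp add: sum.delta)
  thus "vanish_below q (M - ?S)"
    using assms by (auto simp: vanish_below_def)
qed

lemma open_vanish_below: "open {f :: 'a::ab_group_add fls. vanish_below m f}"
  unfolding open_fls_def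
proof (intro ballI exI conjI subsetI; clarsimp)
  fix f g :: "'a fls"
  assume f: "vanish_below m f" and d: "dist g f < inverse (2 ^ nat m)"
  show "vanish_below m g"
  proof (cases "g = f")
    case False
    \<comment> \<open>The radius is at most 1, which excludes the branch of \<open>dist\<close> for
      differences of negative order.\<close>
    have "inverse (2 ^ nat m) \<le> (1::real)" by (simp add: inverse_eq_divide)
    moreover have "(1::real) \<le> 2 ^ nat (- fls_subdegree (g - f))" by simp
    ultimately have nn: "fls_subdegree (g - f) \<ge> 0"
      using d False unfolding dist_fls_def by (simp only: if_False split: if_splits)
    hence "(2::real) ^ nat m < 2 ^ nat (fls_subdegree (g - f))"
      using d False by (simp add: dist_fls_def)
    hence "nat m < nat (fls_subdegree (g - f))" by simp
    hence "(g - f) $$ j = 0" if "j < m" for j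
      using that by (intro fls_eq0_below_subdegree) linarith
    thus ?thesis using f by (simp add: vanish_below_def)
  qed (use f in simp)
qed simp

lemma open_fls_ball_0:
  fixes V :: "'a::ab_group_add fls set"
  assumes "open V" "0 \<in> V"
  obtains N where "\<And>f. vanish_below N f \<Longrightarrow> f \<in> V"
proof -
  obtain r where r: "r > 0" "{y. dist y 0 < r} \<subseteq> V"
    using assms unfolding open_fls_def by blast
  obtain n where n: "inverse (2 ^ n) < r"
    using real_arch_pow_inv[of r "1/2"] r(1) by (auto simp: power_one_over inverse_eq_divide)
  have "f \<in> V" if "vanish_below (int n) f" for f
  proof (cases "f = 0")
    case False
    hence "fls_subdegree f \<ge> int n"
      using that by (intro fls_subdegree_geI) (auto simp: vanish_below_def)
    hence "dist f 0 = inverse (2 ^ nat (fls_subdegree f))" "nat (fls_subdegree f) \<ge> n"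
      using False by (auto simp: dist_fls_def)
    moreover from this have "inverse (2 ^ nat (fls_subdegree f)) \<le> inverse ((2::real) ^ n)"
      by (intro le_imp_inverse_le) auto
    ultimately have "dist f 0 < r" using n by linarith
    thus ?thesis using r(2) by auto
  qed (use assms in simp)
  thus ?thesis using that by blast
qed

lemma continuous_map_fls_const:
  "continuous_map euclidean topology_K (fls_const :: 'a::field fls \<Rightarrow> _)"
  unfolding topology_K_def
proof (rule continuous_on_generated_topo)
  fix B :: "'a fls fls set"
  assume "B \<in> {{M. \<forall>i. M $$ i \<in> U i} |U n. (\<forall>i. open (U i)) \<and> (\<forall>i\<ge>(n::int). U i = UNIV)}"
  then obtain U where B: "B = {M. \<forall>i. M $$ i \<in> U i}" and U: "\<And>i. open (U i)" by auto
  \<comment> \<open>All coefficients of \<open>fls_const g\<close> except the one at 0 vanish, so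
    the conditions at other indices do not depend on \<open>g\<close>.\<close>
  have "fls_const -` B = (if \<forall>i. i \<noteq> 0 \<longrightarrow> 0 \<in> U i then U 0 else {})"
    unfolding B by auto
  thus "openin euclidean (fls_const -` B \<inter> topspace euclidean)"
    using U by simp
next
  have "UNIV \<in> {{M. \<forall>i. M $$ i \<in> U i} |U n. (\<forall>i. open (U i)) \<and> (\<forall>i\<ge>(n::int). U i = (UNIV :: 'a fls set))}"
    by (auto intro!: exI[of _ "\<lambda>_. UNIV"])
  thus "fls_const ` topspace euclidean
    \<subseteq> \<Union> {{M. \<forall>i. M $$ i \<in> U i} |U n. (\<forall>i. open (U i)) \<and> (\<forall>i\<ge>(n::int). U i = (UNIV :: 'a fls set))}"
    by blast
qed

lemma openin_topology_K_nth:
  assumes "open U"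
  shows "openin topology_K {M. M $$ i \<in> U}"
  unfolding topology_K_def
  \<comment> \<open>Only index \<open>i\<close> is constrained, so the required tail of unrestricted
    coefficients can start at \<open>i + 1\<close>.\<close>
  by (rule topology_generated_by_Basis)
     (auto intro!: exI[of _ "\<lambda>j. if j = i then U else UNIV"] exI[of _ "i + 1"] simp: assms
       split: if_splits)

section \<open>Rigidity of continuous additive maps and derivations of k((v))\<close>

text \<open>v-adic continuity at 0 for maps sending 0 to 0; for additive maps this amounts to
  continuity everywhere.\<close>

definition fls_continuous_0 :: "('a::ab_group_add fls \<Rightarrow> 'a fls) \<Rightarrow> bool" where
  "fls_continuous_0 f \<longleftrightarrow> (\<forall>m. \<exists>N. \<forall>g. vanish_below N g \<longrightarrow> vanish_below m (f g))"

lemma fls_continuous_0_diff: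
  assumes "fls_continuous_0 f" "fls_continuous_0 g"
  shows "fls_continuous_0 (\<lambda>x. f x - g x)"
  unfolding fls_continuous_0_def
proof
  fix m
  obtain N N' where "\<And>x. vanish_below N x \<Longrightarrow> vanish_below m (f x)"
     "\<And>x. vanish_below N' x \<Longrightarrow> vanish_below m (g x)"
    using assms unfolding fls_continuous_0_def by meson
  thus "\<exists>N. \<forall>x. vanish_below N x \<longrightarrow> vanish_below m (f x - g x)"
    by (intro exI[of _ "max N N'"]) (auto simp: vanish_below_def)
qed

text \<open>Finite sums of monomials are dense in k((v)), so vanishing on monomials forces vanishing
  everywhere.\<close>

lemma additive_continuous_eq_0:
  fixes f :: "'a::field fls \<Rightarrow> 'a fls"
  assumes add: "\<And>x y. f (x + y) = f x + f y"
    and cont: "fls_continuous_0 f"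
    and mono: "\<And>c i. f (fls_const c * fls_X_intpow i) = 0"
  shows "f g = 0"
proof (intro fls_eqI)
  fix j
  \<comment> \<open>With bound \<open>j + 1\<close>, the image of a tail beyond \<open>N\<close> has
    no coefficient at \<open>j\<close>.\<close>
  obtain N where N: "\<And>x. vanish_below N x \<Longrightarrow> vanish_below (j + 1) (f x)"
    using cont unfolding fls_continuous_0_def by blast
  obtain p where "vanish_below p g" using vanish_below_ex by blast
  then obtain R where R: "g = (\<Sum>i\<in>{p..<N}. fls_const (g $$ i) * fls_X_intpow i) + R"
     "vanish_below N R" by (rule fls_split_at)
  have "f 0 = 0" using add[of 0 0] by (metis add_cancel_right_right)
  hence "f (\<Sum>i\<in>A. fls_const (c i) * fls_X_intpow i) = 0" for A c
    by (induction A rule: infinite_finite_induct) (auto simp: add mono)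
  hence "f g = f R" by (subst R(1)) (simp add: add)
  thus "f g $$ j = 0 $$ j" using N[OF R(2)] by (simp add: vanish_below_def)
qed

lemma fls_continuous_0_deriv: "fls_continuous_0 (fls_deriv :: 'a::field fls \<Rightarrow> _)"
  unfolding fls_continuous_0_def
proof
  fix m
  show "\<exists>N. \<forall>g. vanish_below N g \<longrightarrow> vanish_below m (fls_deriv (g :: 'a fls))"
    by (intro exI[of _ "m + 1"]) (auto simp: vanish_below_def)
qed

lemma fls_continuous_0_id: "fls_continuous_0 (\<lambda>x. x)"
  unfolding fls_continuous_0_def by auto

lemma fls_continuous_0_compose:
  "fls_continuous_0 f \<Longrightarrow> fls_continuous_0 g \<Longrightarrow> fls_continuous_0 (\<lambda>x. f (g x))"
  unfolding fls_continuous_0_def by meson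

lemma fls_continuous_0_times: "fls_continuous_0 ((*) (c :: 'a::field fls))"
  unfolding fls_continuous_0_def
proof (intro allI)
  fix m
  have "(c * x) $$ i = 0" if "vanish_below (m - fls_subdegree c) x" "i < m" for x i
  proof (cases "x = 0")
    case False
    hence "fls_subdegree x \<ge> m - fls_subdegree c"
      using that by (intro fls_subdegree_geI) (auto simp: vanish_below_def)
    thus ?thesis using that by (intro fls_times_nth_eq0) linarith
  qed auto
  thus "\<exists>N. \<forall>x. vanish_below N x \<longrightarrow> vanish_below m (c * x)"
    by (intro exI[of _ "m - fls_subdegree c"]) (auto simp: vanish_below_def)
qed

lemma derivation_continuous_eq_0:
  fixes f :: "'a::field fls \<Rightarrow> 'a fls"
  assumes add: "\<And>x y. f (x + y) = f x + f y"
    and cont: "fls_continuous_0 f"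
    and leibniz: "\<And>x y. f (x * y) = x * f y + f x * y"
    and const: "\<And>c. f (fls_const c) = 0"
    and X: "f fls_X = 0"
  shows "f g = 0"
proof (rule additive_continuous_eq_0[OF add cont])
  fix c i
  have pow: "f (fls_X_intpow (int n)) = 0" for n
  proof (induction n)
    case 0
    show ?case using const[of 1] by simp
  next
    case (Suc n)
    have "fls_X_intpow (int (Suc n)) = fls_X * (fls_X_intpow (int n) :: 'a fls)"
      by (simp add: fls_X_times_conv_shift add.commute)
    thus ?case using leibniz Suc X by simp
  qed
  have "f (fls_X_intpow i) = 0"
  proof (cases "i \<ge> 0")
    case True
    thus ?thesis using pow[of "nat i"] by simp
  next
    case False
    \<comment> \<open>Negative powers: the Leibniz rule is applied to v^n v^(-n) = 1, and the
      nonzero factor v^n is cancelled.\<close>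
    have "fls_X_intpow (int (nat (-i))) * fls_X_intpow i = (1 :: 'a fls)"
      using False by (subst fls_X_intpow_times_fls_X_intpow) simp
    hence "fls_X_intpow (int (nat (-i))) * f (fls_X_intpow i) = 0"
      using leibniz[of "fls_X_intpow (int (nat (-i)))" "fls_X_intpow i"] pow[of "nat (-i)"]
        const[of 1] by simp
    thus ?thesis by (simp add: fls_X_intpow_nonzero fls_shift_eq0_iff)
  qed
  thus "f (fls_const c * fls_X_intpow i) = 0" by (simp add: leibniz const)
qed

section \<open>Multiplication in K and the operators that move powers of z past coefficients\<close>

context local_skew_field
begin

lemma mul_assoc: "(M \<star> N) \<star> P = M \<star> (N \<star> P)"
proof -
  interpret R: ring_1 1 "(\<star>)" "(+)" 0 "(-)" uminus by (rule ring_1)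
  show ?thesis by (rule R.mult.assoc)
qed

lemma mul_distrib: "(M + N) \<star> P = M \<star> P + N \<star> P" "M \<star> (N + P) = M \<star> N + M \<star> P"
  and mul_zero [simp]: "0 \<star> M = 0" "M \<star> 0 = 0"
  and mul_one [simp]: "1 \<star> M = M" "M \<star> 1 = M"
proof -
  interpret R: ring_1 1 "(\<star>)" "(+)" 0 "(-)" uminus by (rule ring_1)
  show "(M + N) \<star> P = M \<star> P + N \<star> P" "M \<star> (N + P) = M \<star> N + M \<star> P"
    by (rule R.distrib_right R.distrib_left)+
  show "0 \<star> M = 0" "M \<star> 0 = 0" "1 \<star> M = M" "M \<star> 1 = M" by simp_all
qed

lemma mul_sum: "(\<Sum>i\<in>A. f i) \<star> M = (\<Sum>i\<in>A. f i \<star> M)" "M \<star> (\<Sum>i\<in>A. f i) = (\<Sum>i\<in>A. M \<star> f i)"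
  by (induction A rule: infinite_finite_induct; simp add: mul_distrib)+

lemma vanish_below_mul:
  assumes "vanish_below p M" "vanish_below q N"
  shows "vanish_below (p + q) (M \<star> N)"
proof (cases "M = 0 \<or> N = 0")
  case False
  hence "fls_subdegree M \<ge> p" "fls_subdegree N \<ge> q"
    using assms by (auto intro!: fls_subdegree_geI simp: vanish_below_def)
  thus ?thesis using False by (auto simp: vanish_below_def valuation_mul)
qed (auto simp: vanish_below_def)

text \<open>\<open>z_right\<close> makes \<open>z_inv_K\<close> a left inverse of
  \<open>z_K\<close>, hence equal to the right inverse supplied by the skew field axiom.\<close>

lemma z_inv_right: "M \<star> z_inv_K = M * z_inv_K"
proof -
  have 1: "M' * z_inv_K \<star> z_K = M'" for M'
    by (simp add: z_right fls_X_times_conv_shift fls_X_inv_times_conv_shift)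
  have "z_K \<star> z_inv_K = 1"
  proof -
    obtain N where N: "z_K \<star> N = 1" using inverse_exists[of z_K] by auto
    have "z_inv_K = z_inv_K \<star> (z_K \<star> N)" by (simp add: N)
    also have "\<dots> = N" unfolding mul_assoc[symmetric] using 1[of 1] by simp
    finally show ?thesis using N by simp
  qed
  thus ?thesis using mul_assoc[of "M * z_inv_K" z_K z_inv_K] by (simp add: 1)
qed

text \<open>On the right, powers of z merely shift indices, so the noncommutativity sits entirely in
  the products z^i g expanded by \<open>sig\<close>.\<close>

lemma X_intpow_right: "M \<star> fls_X_intpow i = M * fls_X_intpow i"
proof (induction i rule: int_induct[where k = 0])
  case base
  show ?case by simp
next
  case (step1 i)
  have eq: "(fls_X_intpow (i + 1) :: 'a fls fls) = fls_X_intpow i \<star> z_K"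
    by (simp add: z_right fls_X_times_conv_shift)
  show ?case unfolding eq
    unfolding mul_assoc[symmetric] unfolding step1(2) z_right mult.assoc ..
next
  case (step2 i)
  have eq: "(fls_X_intpow (i - 1) :: 'a fls fls) = fls_X_intpow i \<star> z_inv_K"
    by (simp add: z_inv_right fls_X_inv_times_conv_shift)
  show ?case unfolding eq
    unfolding mul_assoc[symmetric] unfolding step2(2) z_inv_right mult.assoc ..
qed

text \<open>\<open>z\<^sup>i g = \<Sum>\<^sub>k (sig i k g) z\<^bsup>i+k\<^esup>\<close> for \<open>g \<in> k((v))\<close>.\<close>

definition sig :: "int \<Rightarrow> int \<Rightarrow> 'a fls \<Rightarrow> 'a fls" where
  "sig i k g = (fls_X_intpow i \<star> fls_const g) $$ (i + k)"

lemma sig_add: "sig i k (f + g) = sig i k f + sig i k g"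
  by (simp add: sig_def mul_distrib flip: fls_plus_const)

lemma sig_zero [simp]: "sig i k 0 = 0"
  using sig_add[of i k 0 0] by (metis add_cancel_right_right)

lemma sig_uminus: "sig i k (- g) = - sig i k g"
  using sig_add[of i k g "- g"] by (simp add: eq_neg_iff_add_eq_0 add.commute)

lemma sig_diff: "sig i k (f - g) = sig i k f - sig i k g"
  using sig_add[of i k f "- g"] by (simp add: sig_uminus)

text \<open>Elements of k are central, so they cross z^i unchanged.\<close>

lemma sig_scale: "sig i k (fls_const c * g) = fls_const c * sig i k g"
proof -
  have "fls_X_intpow i \<star> fls_const (fls_const c * g) = (fls_X_intpow i \<star> k_to_K c) \<star> fls_const g"
    by (simp add: mul_assoc coeff_left fls_const_mult_const)
  also have "\<dots> = k_to_K c * (fls_X_intpow i \<star> fls_const g)"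
    unfolding central[symmetric] unfolding mul_assoc unfolding coeff_left ..
  finally show ?thesis by (simp add: sig_def)
qed

lemma sig_numeral: "sig i k (numeral w * g) = numeral w * sig i k g"
  using sig_scale[of i k "numeral w" g] by (simp only: fls_const_numeral)

lemma vanish_below_X_intpow: "vanish_below i (fls_X_intpow i)"
  by (auto simp: vanish_below_def)

lemma vanish_below_const: "vanish_below 0 (fls_const g)"
  by (auto simp: vanish_below_def)

lemma sig_0: "sig 0 k g = (if k = 0 then g else 0)"
  by (simp add: sig_def)

lemma sig_one: "sig i k 1 = (if k = 0 then 1 else 0)"
  by (simp add: sig_def)

text \<open>Both factors are cut where their tails can no longer reach z^n;
  \<open>vanish_below_mul\<close> discards the tails, and the remaining finite sums are expanded by
  distributivity.\<close>

lemma mul_nth: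
  assumes M: "vanish_below p M" and N: "vanish_below q N"
  shows "(M \<star> N) $$ n = (\<Sum>i\<in>{p..n-q}. M $$ i * (\<Sum>j\<in>{q..n-i}. sig i (n - i - j) (N $$ j)))"
proof -
  obtain R where R: "M = (\<Sum>i\<in>{p..<n-q+1}. fls_const (M $$ i) * fls_X_intpow i) + R"
    "vanish_below (n-q+1) R" using M by (rule fls_split_at)
  have "(R \<star> N) $$ n = 0"
    using vanish_below_mul[OF R(2) N] by (simp add: vanish_below_def)
  hence "(M \<star> N) $$ n = (\<Sum>i\<in>{p..<n-q+1}. M $$ i * (fls_X_intpow i \<star> N) $$ n)"
    by (subst R(1)) (simp add: mul_distrib mul_sum fls_nth_sum mul_assoc flip: coeff_left,
          simp add: coeff_left)
  also have "\<dots> = (\<Sum>i\<in>{p..n-q}. M $$ i * (\<Sum>j\<in>{q..n-i}. sig i (n - i - j) (N $$ j)))"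
  proof (intro sum.cong refl)
    fix i
    obtain S where S: "N = (\<Sum>j\<in>{q..<n-i+1}. fls_const (N $$ j) * fls_X_intpow j) + S"
      "vanish_below (n-i+1) S" using N by (rule fls_split_at)
    have S0: "(fls_X_intpow i \<star> S) $$ n = 0"
      using vanish_below_mul[OF vanish_below_X_intpow S(2)] by (simp add: vanish_below_def)
    have "(fls_X_intpow i \<star> N) $$ n
        = (\<Sum>j\<in>{q..<n-i+1}. (fls_X_intpow i \<star> (fls_const (N $$ j) \<star> fls_X_intpow j)) $$ n)"
      by (subst S(1)) (simp add: mul_distrib mul_sum fls_nth_sum S0 coeff_left del: fls_const_mult_const)
    also have "\<dots> = (\<Sum>j\<in>{q..<n-i+1}. sig i (n - i - j) (N $$ j))"
      unfolding mul_assoc[symmetric]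
      by (simp only: sig_def X_intpow_right fls_X_intpow_times_conv_shift
          fls_shift_nth) (simp add: algebra_simps)
    also have "{q..<n-i+1} = {q..n-i}" by auto
    finally show "M $$ i * (fls_X_intpow i \<star> N) $$ n = M $$ i * (\<Sum>j\<in>{q..n-i}. sig i (n - i - j) (N $$ j))"
      by simp
  qed auto
  finally show ?thesis .
qed


text \<open>Associativity applied to z^i (z^i' g).\<close>

lemma sig_comp: "sig (i + i') k g = (\<Sum>l\<in>{0..k}. sig i (k - l) (sig i' l g))"
proof -
  have "(fls_X_intpow (i + i') :: 'a fls fls) = fls_X_intpow i \<star> fls_X_intpow i'"
    by (simp only: X_intpow_right fls_X_intpow_times_fls_X_intpow)
  hence "sig (i + i') k g = (fls_X_intpow i \<star> (fls_X_intpow i' \<star> fls_const g)) $$ (i + i' + k)"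
    by (simp only: sig_def mul_assoc)
  also have "\<dots> = (\<Sum>h\<in>{i..i+k}. (fls_X_intpow i :: 'a fls fls) $$ h *
      (\<Sum>j\<in>{i'..i+i'+k-h}. sig h (i + i' + k - h - j) ((fls_X_intpow i' \<star> fls_const g) $$ j)))"
    using vanish_below_mul[OF vanish_below_X_intpow[of i'] vanish_below_const[of g]]
    by (subst mul_nth[OF vanish_below_X_intpow, where q = i']) (simp_all add: algebra_simps)
  also have "\<dots> = (\<Sum>h\<in>{i..i+k}. if h = i then
      (\<Sum>j\<in>{i'..i'+k}. sig i (i' + k - j) ((fls_X_intpow i' \<star> fls_const g) $$ j)) else 0)"
    by (intro sum.cong) (auto simp: algebra_simps)
  also have "\<dots> = (\<Sum>j\<in>{i'..i'+k}. sig i (i' + k - j) ((fls_X_intpow i' \<star> fls_const g) $$ j))"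
    by (simp add: sum.delta')
  also have "\<dots> = (\<Sum>l\<in>{0..k}. sig i (k - l) (sig i' l g))"
    by (rule sum.reindex_bij_witness[where i = "\<lambda>l. i' + l" and j = "\<lambda>j. j - i'"])
       (auto simp: sig_def algebra_simps)
  finally show ?thesis .
qed

text \<open>Associativity applied to (z^i f) g. After crossing \<open>f\<close>, the term z^(i+l)
  still has to cross \<open>g\<close>, which explains the index \<open>i + l\<close> in the second
  factor.\<close>

lemma sig_leibniz: "sig i k (f * g) = (\<Sum>l\<in>{0..k}. sig i l f * sig (i + l) (k - l) g)"
proof -
  have "sig i k (f * g) = ((fls_X_intpow i \<star> fls_const f) \<star> fls_const g) $$ (i + k)"
    by (simp only: sig_def mul_assoc coeff_left fls_const_mult_const)
  also have "\<dots> = (\<Sum>h\<in>{i..i+k}. (fls_X_intpow i \<star> fls_const f) $$ h *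
      (\<Sum>j\<in>{0..i+k-h}. sig h (i + k - h - j) (fls_const g $$ j)))"
    using vanish_below_mul[OF vanish_below_X_intpow[of i] vanish_below_const[of f]]
    by (subst mul_nth[OF _ vanish_below_const, where p = i]) simp_all
  also have "\<dots> = (\<Sum>h\<in>{i..i+k}. sig i (h - i) f * sig h (i + k - h) g)"
  proof (intro sum.cong refl)
    fix h assume h: "h \<in> {i..i+k}"
    have "(\<Sum>j\<in>{0..i+k-h}. sig h (i + k - h - j) (fls_const g $$ j))
        = (\<Sum>j\<in>{0..i+k-h}. if j = 0 then sig h (i + k - h) g else 0)"
      by (intro sum.cong) auto
    thus "(fls_X_intpow i \<star> fls_const f) $$ h *
      (\<Sum>j\<in>{0..i+k-h}. sig h (i + k - h - j) (fls_const g $$ j))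
      = sig i (h - i) f * sig h (i + k - h) g"
      using h by (simp add: sum.delta' sig_def)
  qed
  also have "\<dots> = (\<Sum>l\<in>{0..k}. sig i l f * sig (i + l) (k - l) g)"
    by (rule sum.reindex_bij_witness[where i = "\<lambda>l. i + l" and j = "\<lambda>j. j - i"])
       (auto simp: algebra_simps)
  finally show ?thesis .
qed

text \<open>Left multiplication is continuous on K, and prescribing an open set for a single
  coefficient is an open condition; the preimage is thus a neighbourhood of 0 in k((v)).\<close>

lemma sig_continuous_0: "fls_continuous_0 (sig i k)"
  unfolding fls_continuous_0_def
proof
  fix m
  let ?W = "{M. M $$ (i + k) \<in> {f :: 'a fls. vanish_below m f}}"
  have "continuous_map euclidean topology_K (\<lambda>g. fls_X_intpow i \<star> fls_const g)"
    using continuous_map_compose[OF continuous_map_fls_const continuous_left]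
    by (simp add: o_def)
  moreover have "openin topology_K ?W" by (intro openin_topology_K_nth open_vanish_below)
  ultimately have "openin euclidean {g \<in> topspace euclidean. fls_X_intpow i \<star> fls_const g \<in> ?W}"
    by (rule openin_continuous_map_preimage)
  hence "open {g. vanish_below m (sig i k g)}" by (simp add: sig_def)
  moreover have "0 \<in> {g. vanish_below m (sig i k g)}" by (simp add: vanish_below_def)
  ultimately obtain N where "\<And>g. vanish_below N g \<Longrightarrow> g \<in> {g. vanish_below m (sig i k g)}"
    by (rule open_fls_ball_0) auto
  thus "\<exists>N. \<forall>g. vanish_below N g \<longrightarrow> vanish_below m (sig i k g)" by blast
qed

section \<open>Explicit formulas for the low-order commutation operators\<close>

text \<open>As a simplification rule this unrolls sums with numeric bounds; the conditional makes
  the unrolling stop.\<close>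

lemma sum_int_Suc_lower:
  "(\<Sum>i\<in>{m..n::int}. f i) = (if n < m then 0 else f m + (\<Sum>i\<in>{m+1..n}. f i))"
  by (subst simp_from_to) simp

text \<open>The defining relation, read off coefficientwise; the factor \<open>z_inv_K\<close>
  shifts the index by one.\<close>

lemma sig_1_X: "sig 1 k fls_X = (if k = 0 then fls_X else if k = 1 then 1
    else if k = 2 then fls_const a * fls_X_inv else 0)"
proof -
  have "sig 1 k fls_X = ((z_K \<star> fls_const fls_X) \<star> z_inv_K) $$ k"
    by (simp add: z_inv_right fls_X_inv_times_conv_shift sig_def add.commute
        flip: fls_X_conv_shift_1)
  also have "\<dots> = (fls_const fls_X + z_K + fls_const (fls_const a * fls_X_inv) * z_K ^ 2) $$ k"
    by (simp only: relation)
  finally show ?thesis by auto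
qed

lemma sig_1_0: "sig 1 0 g = g"
proof -
  \<comment> \<open>A continuous ring endomorphism of \<open>k((v))\<close> fixing \<open>k\<close> and \<open>v\<close> is the identity.\<close>
  have mult: "sig 1 0 (f * g) = sig 1 0 f * sig 1 0 g" for f g
    by (simp add: sig_leibniz)
  have pow: "sig 1 0 (fls_X_intpow (int n)) = fls_X_intpow (int n)" for n
  proof (induction n)
    case (Suc n)
    have "fls_X_intpow (int (Suc n)) = fls_X * (fls_X_intpow (int n) :: 'a fls)"
      by (simp add: fls_X_times_conv_shift add.commute)
    thus ?case using Suc by (simp only: mult sig_1_X simp_thms if_True)
  qed (simp add: sig_one)
  have powi: "sig 1 0 (fls_X_intpow i) = fls_X_intpow i" for i
  proof (cases "i \<ge> 0")
    case True
    thus ?thesis using pow[of "nat i"] by simp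
  next
    case False
    let ?X = "fls_X_intpow (int (nat (-i))) :: 'a fls"
    have 1: "?X * fls_X_intpow i = 1"
      using False by (subst fls_X_intpow_times_fls_X_intpow) simp
    hence "?X * sig 1 0 (fls_X_intpow i) = ?X * fls_X_intpow i"
      using mult[of ?X "fls_X_intpow i"] by (simp only: pow) (simp only: sig_one simp_thms if_True)
    thus ?thesis using fls_X_intpow_nonzero[of "int (nat (-i))", where ?'a = 'a]
      by (simp only: mult_cancel_left) blast
  qed
  have "sig 1 0 g - g = 0"
    by (rule additive_continuous_eq_0[where f = "\<lambda>g. sig 1 0 g - g"])
       (auto simp: sig_add sig_scale powi intro!: fls_continuous_0_diff sig_continuous_0
         fls_continuous_0_id simp del: fls_const_mult_const)
  thus ?thesis by simp
qed

text \<open>In order 0 \<open>sig_comp\<close> is plain composition, so the case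
  \<open>i = 1\<close> propagates in both directions.\<close>

lemma sig_i_0: "sig i 0 g = g"
proof (induction i arbitrary: g rule: int_induct[where k = 0])
  case base
  show ?case by (simp add: sig_0)
next
  case (step1 i)
  thus ?case using sig_comp[of i 1 0 g] by (simp add: sig_1_0)
next
  case (step2 i)
  thus ?case using sig_comp[of 1 "i - 1" 0 g] by (simp add: sig_1_0)
qed

text \<open>In order 1 \<open>sig_leibniz\<close> is the ordinary Leibniz rule, and the relation
  gives the value 1 at v.\<close>

lemma sig_1_1: "sig 1 1 g = fls_deriv g"
proof -
  have "sig 1 1 g - fls_deriv g = 0"
    by (rule derivation_continuous_eq_0[where f = "\<lambda>g. sig 1 1 g - fls_deriv g"])
       (use sig_scale[of 1 1 _ 1] in \<open>auto simp: sig_add sig_leibniz sum_int_Suc_lower sig_i_0 algebra_simps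
          sig_one sig_1_X
         intro!: fls_continuous_0_diff sig_continuous_0 fls_continuous_0_deriv\<close>)
  thus ?thesis by simp
qed

lemma sig_2_1: "sig 2 1 g = 2 * fls_deriv g"
  using sig_comp[of 1 1 1 g] by (simp add: sum_int_Suc_lower sig_i_0 sig_1_1)

lemma sig_1_2:
  "sig 1 2 g = fls_deriv (fls_deriv g) + fls_const a * fls_X_inv * fls_deriv g"
proof -
  \<comment> \<open>Since \<open>sig 2 1\<close> is 2 d/dv, the Leibniz defect of
    \<open>sig 1 2\<close> is 2 f' g', the same as for the second derivative. Subtracting the latter
    leaves a derivation, whose value a/v at v fixes the last term.\<close>
  define f where "f = (\<lambda>g. sig 1 2 g - fls_deriv (fls_deriv g)
    - fls_const a * fls_X_inv * fls_deriv g)"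
  have "f g = 0"
  proof (rule derivation_continuous_eq_0[where f = f])
    show "fls_continuous_0 f" unfolding f_def
      by (intro fls_continuous_0_diff sig_continuous_0 fls_continuous_0_deriv
          fls_continuous_0_compose[OF fls_continuous_0_times]
          fls_continuous_0_compose[OF fls_continuous_0_deriv])
    show "f (x + y) = f x + f y" for x y
      by (simp add: f_def sig_add algebra_simps)
    show "f (x * y) = x * f y + f x * y" for x y
      by (simp add: f_def sig_leibniz sum_int_Suc_lower sig_i_0 sig_1_1 sig_2_1 algebra_simps)
    show "f (fls_const c) = 0" for c
      using sig_scale[of 1 2 c 1] by (simp add: f_def sig_one)
    show "f fls_X = 0"
      by (simp add: f_def sig_1_X)
  qed
  thus ?thesis by (simp add: f_def algebra_simps)
qed

text \<open>From z z^(-1) = 1: the positive-order parts of the composite must vanish.\<close>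

lemma sig_m1_1: "sig (-1) 1 g = - fls_deriv g"
  using sig_comp[of 1 "-1" 1 g]
  by (simp add: sum_int_Suc_lower sig_i_0 sig_1_1 sig_0 eq_neg_iff_add_eq_0 add.commute)

text \<open>Again z z^(-1) = 1; the two second-derivative terms cancel.\<close>

lemma sig_m1_2: "sig (-1) 2 g = - (fls_const a * fls_X_inv * fls_deriv g)"
  using sig_comp[of 1 "-1" 2 g]
  by (simp add: sum_int_Suc_lower sig_i_0 sig_1_1 sig_1_2 sig_0 sig_m1_1 eq_neg_iff_add_eq_0
      add.commute)


text \<open>Iterating z^(-1). The operator \<open>sig (-1) 3\<close> stays symbolic because it
  cancels in both commutators below.\<close>

lemma sig_m2:
  "sig (-2) 1 g = 2 * sig (-1) 1 g"
  "sig (-2) 2 g = 2 * sig (-1) 2 g + sig (-1) 1 (sig (-1) 1 g)"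
  "sig (-2) 3 g = 2 * sig (-1) 3 g + sig (-1) 1 (sig (-1) 2 g) + sig (-1) 2 (sig (-1) 1 g)"
  using sig_comp[of "-1" "-1" _ g] by (simp_all add: sum_int_Suc_lower sig_i_0)

lemma sig_m3:
  "sig (-3) 1 g = 3 * sig (-1) 1 g"
  "sig (-3) 2 g = 3 * sig (-1) 2 g + 3 * sig (-1) 1 (sig (-1) 1 g)"
  "sig (-3) 3 g = 3 * sig (-1) 3 g + 3 * sig (-1) 1 (sig (-1) 2 g)
     + 3 * sig (-1) 2 (sig (-1) 1 g) + sig (-1) 1 (sig (-1) 1 (sig (-1) 1 g))"
  using sig_comp[of "-1" "-2" _ g] by (simp_all add: sum_int_Suc_lower sig_i_0 sig_m2 sig_add
    sig_numeral)

section \<open>Products of power series in the variables t_m\<close>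

text \<open>Reduces products over K to Cauchy products over the commutative field k((v)), where both
  orders of a product can be identified.\<close>

lemma t_mult_nth:
  assumes "\<And>\<alpha>. vanish_below p (F \<alpha>)" "\<And>\<alpha>. vanish_below q (G \<alpha>)"
  shows "t_mult (\<star>) F G \<alpha> $$ n = (\<Sum>i\<in>{p..n-q}. \<Sum>j\<in>{q..n-i}.
    t_mult (*) (\<lambda>\<alpha>. F \<alpha> $$ i) (\<lambda>\<alpha>. sig i (n - i - j) (G \<alpha> $$ j)) \<alpha>)"
proof -
  have "t_mult (\<star>) F G \<alpha> $$ n = (\<Sum>x\<in>{(\<beta>, \<gamma>). \<beta> + \<gamma> = \<alpha>}. \<Sum>i\<in>{p..n-q}. \<Sum>j\<in>{q..n-i}.
      F (fst x) $$ i * sig i (n - i - j) (G (snd x) $$ j))"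
    unfolding t_mult_def fls_nth_sum
    by (intro sum.cong refl) (auto simp: mul_nth[OF assms] sum_distrib_left)
  also have "\<dots> = (\<Sum>i\<in>{p..n-q}. \<Sum>j\<in>{q..n-i}. \<Sum>x\<in>{(\<beta>, \<gamma>). \<beta> + \<gamma> = \<alpha>}.
      F (fst x) $$ i * sig i (n - i - j) (G (snd x) $$ j))"
    by (subst sum.swap) (intro sum.cong refl sum.swap)
  finally show ?thesis by (simp add: t_mult_def case_prod_unfold)
qed

lemma t_mult_vanish_below:
  assumes "\<And>\<alpha>. vanish_below p (F \<alpha>)" "\<And>\<alpha>. vanish_below q (G \<alpha>)"
  shows "vanish_below (p + q) (t_mult (\<star>) F G \<alpha>)"
  using vanish_below_mul[OF assms]
  unfolding vanish_below_def t_mult_def fls_nth_sum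
  by (auto intro!: sum.neutral)

end

lemma t_mult_const_left:
  assumes "\<And>x. mul 0 x = 0"
  shows "t_mult mul (t_const c) F \<alpha> = mul c (F \<alpha>)"
proof -
  have "t_mult mul (t_const c) F \<alpha>
      = (\<Sum>x\<in>{(\<beta>, \<gamma>). \<beta> + \<gamma> = \<alpha>}. if x = (0, \<alpha>) then mul c (F \<alpha>) else 0)"
    unfolding t_mult_def by (intro sum.cong) (auto simp: t_const_def assms split: if_splits)
  thus ?thesis using finite_tmon_decompositions[of \<alpha>] by simp
qed

lemma t_mult_comm: "t_mult (*) F (G :: 'a::comm_semiring_1 tseries) = t_mult (*) G F"
proof
  fix \<alpha>
  show "t_mult (*) F G \<alpha> = t_mult (*) G F \<alpha>"
    unfolding t_mult_def
    by (rule sum.reindex_bij_witness[where i = prod.swap and j = prod.swap])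
       (auto simp: add.commute mult.commute)
qed

lemma t_mult_linear:
  fixes F G H :: "'a::comm_ring_1 tseries"
  shows "t_mult (*) (\<lambda>\<alpha>. c * F \<alpha>) G \<alpha> = c * t_mult (*) F G \<alpha>"
    "t_mult (*) F (\<lambda>\<alpha>. c * G \<alpha>) \<alpha> = c * t_mult (*) F G \<alpha>"
    "t_mult (*) (\<lambda>\<alpha>. F \<alpha> + G \<alpha>) H \<alpha> = t_mult (*) F H \<alpha> + t_mult (*) G H \<alpha>"
    "t_mult (*) H (\<lambda>\<alpha>. F \<alpha> + G \<alpha>) \<alpha> = t_mult (*) H F \<alpha> + t_mult (*) H G \<alpha>"
    "t_mult (*) (\<lambda>\<alpha>. - F \<alpha>) G \<alpha> = - t_mult (*) F G \<alpha>"
    "t_mult (*) F (\<lambda>\<alpha>. - G \<alpha>) \<alpha> = - t_mult (*) F G \<alpha>"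
    "t_mult (*) (\<lambda>\<alpha>. F \<alpha> - G \<alpha>) H \<alpha> = t_mult (*) F H \<alpha> - t_mult (*) G H \<alpha>"
    "t_mult (*) H (\<lambda>\<alpha>. F \<alpha> - G \<alpha>) \<alpha> = t_mult (*) H F \<alpha> - t_mult (*) H G \<alpha>"
  by (simp_all add: t_mult_def case_prod_unfold sum_distrib_left sum.distrib sum_negf
      sum_subtractf algebra_simps)

lemma t_mult_0: "t_mult (*) (\<lambda>_. 0) G = (\<lambda>_. 0 :: 'a::comm_ring_1)" "t_mult (*) F (\<lambda>_. 0) = (\<lambda>_. 0 :: 'a::comm_ring_1)"
  by (simp_all add: t_mult_def)

lemma t_mult_one: "t_mult (*) (t_const 1) F = (F :: 'a::comm_ring_1 tseries)" "t_mult (*) F (t_const 1) = F"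
  by (simp_all add: t_mult_comm[of F "t_const 1"] t_mult_const_left fun_eq_iff)

section \<open>Powers of the Lax operator and the flows of t_2 and t_3\<close>

context local_skew_field
begin

text \<open>The assumption is the coefficient form of L lying in z^(-1) + K_-; the leading
  coefficient is the series 1, constant in all t_m, hence \<open>t_const 1\<close>.\<close>

context
  fixes L :: "'a fls fls tseries"
  assumes L_nonpos: "\<And>i \<alpha>. i \<le> 0 \<Longrightarrow> L \<alpha> $$ i = (if i = -1 then t_const 1 \<alpha> else 0)"
begin

lemma vanish_below_Lax: "vanish_below (-1) (L \<alpha>)"
  by (simp add: vanish_below_def L_nonpos)

lemma sig_t_const: "sig i k (t_const 1 \<alpha>) = (if k = 0 then t_const 1 \<alpha> else 0)"
  by (simp add: t_const_def sig_one)

lemma Lax_pow_1: "t_pow (\<star>) L (Suc 0) = L"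
  by (simp add: t_mult_const_left fun_eq_iff)

lemmas t_mult_coeff_simps = sum_int_Suc_lower sig_t_const L_nonpos t_mult_0 t_mult_one
  sig_i_0 sig_0 t_mult_linear

lemma vanish_below_Lax_pow_2: "vanish_below (-2) (t_pow (\<star>) L 2 \<alpha>)"
  using t_mult_vanish_below[of "-1" L "-1" L, OF vanish_below_Lax vanish_below_Lax]
  by (simp add: numeral_2_eq_2 Lax_pow_1 del: t_pow.simps(2) add: t_pow.simps(2)[of _ _ "Suc 0"])

text \<open>The coefficient of z lies outside the plus part of L^2, but it enters the constant term
  of L^3.\<close>

lemma Lax_pow_2_nth:
  "t_pow (\<star>) L 2 \<alpha> $$ (-2) = t_const 1 \<alpha>"
  "t_pow (\<star>) L 2 \<alpha> $$ (-1) = 0"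
  "t_pow (\<star>) L 2 \<alpha> $$ 0 = 2 * L \<alpha> $$ 1"
  "t_pow (\<star>) L 2 \<alpha> $$ 1 = 2 * L \<alpha> $$ 2 - fls_deriv (L \<alpha> $$ 1)"
proof -
  have 2: "t_pow (\<star>) L 2 = t_mult (\<star>) L L"
    by (simp add: numeral_2_eq_2 Lax_pow_1 del: t_pow.simps(2) add: t_pow.simps(2)[of _ _ "Suc 0"])
  note N = t_mult_nth[of "-1" L "-1" L, OF vanish_below_Lax vanish_below_Lax]
  show "t_pow (\<star>) L 2 \<alpha> $$ (-2) = t_const 1 \<alpha>"
    "t_pow (\<star>) L 2 \<alpha> $$ (-1) = 0"
    "t_pow (\<star>) L 2 \<alpha> $$ 0 = 2 * L \<alpha> $$ 1"
    "t_pow (\<star>) L 2 \<alpha> $$ 1 = 2 * L \<alpha> $$ 2 - fls_deriv (L \<alpha> $$ 1)"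
    unfolding 2 N by (simp_all add: t_mult_coeff_simps sig_m1_1)
qed

lemma Lax_pow_3_nth:
  "t_pow (\<star>) L 3 \<alpha> $$ (-3) = t_const 1 \<alpha>"
  "t_pow (\<star>) L 3 \<alpha> $$ (-2) = 0"
  "t_pow (\<star>) L 3 \<alpha> $$ (-1) = 3 * L \<alpha> $$ 1"
  "t_pow (\<star>) L 3 \<alpha> $$ 0 = 3 * L \<alpha> $$ 2 - 3 * fls_deriv (L \<alpha> $$ 1)"
  "vanish_below (-3) (t_pow (\<star>) L 3 \<alpha>)"
proof -
  have 3: "t_pow (\<star>) L 3 = t_mult (\<star>) (t_pow (\<star>) L 2) L"
    by (simp add: numeral_3_eq_3 numeral_2_eq_2)
  note N = t_mult_nth[of "-2" "t_pow (\<star>) L 2" "-1" L, OF vanish_below_Lax_pow_2 vanish_below_Lax]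
  show "t_pow (\<star>) L 3 \<alpha> $$ (-3) = t_const 1 \<alpha>"
    "t_pow (\<star>) L 3 \<alpha> $$ (-2) = 0"
    "t_pow (\<star>) L 3 \<alpha> $$ (-1) = 3 * L \<alpha> $$ 1"
    "t_pow (\<star>) L 3 \<alpha> $$ 0 = 3 * L \<alpha> $$ 2 - 3 * fls_deriv (L \<alpha> $$ 1)"
    unfolding 3 N by (simp_all add: t_mult_coeff_simps Lax_pow_2_nth sig_m2 sig_m1_1)
  show "vanish_below (-3) (t_pow (\<star>) L 3 \<alpha>)"
    using t_mult_vanish_below[OF vanish_below_Lax_pow_2 vanish_below_Lax] unfolding 3 by simp
qed

lemma plus_part_Lax_pow_2_nth:
  "plus_part (t_pow (\<star>) L 2 \<alpha>) $$ i
     = (if i = -2 then t_const 1 \<alpha> else if i = 0 then 2 * L \<alpha> $$ 1 else 0)"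
proof -
  consider "i < -2" | "i = -2" | "i = -1" | "i = 0" | "i > 0" by linarith
  thus ?thesis
    using vanish_below_Lax_pow_2[of \<alpha>] by cases (auto simp: nth_plus_part Lax_pow_2_nth vanish_below_def)
qed

lemma plus_part_Lax_pow_3_nth:
  "plus_part (t_pow (\<star>) L 3 \<alpha>) $$ i
     = (if i = -3 then t_const 1 \<alpha> else if i = -1 then 3 * L \<alpha> $$ 1
     else if i = 0 then 3 * L \<alpha> $$ 2 - 3 * fls_deriv (L \<alpha> $$ 1) else 0)"
proof -
  consider "i < -3" | "i = -3" | "i = -2" | "i = -1" | "i = 0" | "i > 0" by linarith
  thus ?thesis
    using Lax_pow_3_nth(5)[of \<alpha>] by cases (auto simp: nth_plus_part Lax_pow_3_nth vanish_below_def)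
qed

text \<open>These coefficients yield the t_2-derivatives of u_1 and u_2. In the second,
  \<open>sig (-1) 3\<close> occurs twice in each product and cancels; the quadratic term comes from
  moving z past 2 u_1 in \<open>L\<close> times \<open>B\<close>.\<close>

lemma Lax_commutator_2_nth:
  defines "B \<equiv> \<lambda>\<alpha>. plus_part (t_pow (\<star>) L 2 \<alpha>)"
  shows "t_commutator (\<star>) B L \<alpha> $$ 1 =
     fls_deriv (fls_deriv (L \<alpha> $$ 1)) - 2 * fls_deriv (L \<alpha> $$ 2)" (is ?A)
  and "t_commutator (\<star>) B L \<alpha> $$ 2 =
     sig (-1) 1 (sig (-1) 2 (L \<alpha> $$ 1)) + sig (-1) 2 (sig (-1) 1 (L \<alpha> $$ 1))
     + fls_deriv (fls_deriv (L \<alpha> $$ 2)) + 2 * sig (-1) 2 (L \<alpha> $$ 2)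
     - 2 * fls_deriv (L \<alpha> $$ 3)
     - 2 * t_mult (*) (\<lambda>\<alpha>. L \<alpha> $$ 1) (\<lambda>\<alpha>. fls_deriv (L \<alpha> $$ 1)) \<alpha>" (is ?B)
proof -
  have v: "vanish_below (-2) (B \<alpha>)" for \<alpha>
    by (simp add: vanish_below_def B_def plus_part_Lax_pow_2_nth)
  have B: "B \<alpha> $$ i = (if i = -2 then t_const 1 \<alpha> else if i = 0 then 2 * L \<alpha> $$ 1 else 0)" for \<alpha> i
    by (simp add: B_def plus_part_Lax_pow_2_nth)
  note N = t_mult_nth[of "-2" B "-1" L, OF v vanish_below_Lax] t_mult_nth[of "-1" L "-2" B, OF vanish_below_Lax v]
  show ?A
    unfolding t_commutator_def fls_minus_nth N
    by (simp add: t_mult_coeff_simps B sig_m2 sig_m1_1 sig_numeral sig_1_1)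
  show ?B
    unfolding t_commutator_def fls_minus_nth N
    \<comment> \<open>Commutativity of the coefficients cancels the products of u_1 and u_2.\<close>
    by (simp add: t_mult_coeff_simps B sig_m2 sig_m1_1 sig_numeral sig_1_1
        t_mult_comm[of "\<lambda>\<alpha>. L \<alpha> $$ 2" "\<lambda>\<alpha>. L \<alpha> $$ 1"])
qed

text \<open>Besides \<open>sig (-1) 3\<close>, the terms with \<open>sig (-1) 2\<close> applied to
  u_2 or to the derivative of u_1 cancel against those from the constant term of
  \<open>B\<close>.\<close>

lemma Lax_commutator_3_nth:
  defines "B \<equiv> \<lambda>\<alpha>. plus_part (t_pow (\<star>) L 3 \<alpha>)"
  shows "t_commutator (\<star>) B L \<alpha> $$ 1 =
     3 * sig (-1) 1 (sig (-1) 2 (L \<alpha> $$ 1)) - fls_deriv (fls_deriv (fls_deriv (L \<alpha> $$ 1)))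
     + 3 * fls_deriv (fls_deriv (L \<alpha> $$ 2)) - 3 * fls_deriv (L \<alpha> $$ 3)
     - 6 * t_mult (*) (\<lambda>\<alpha>. L \<alpha> $$ 1) (\<lambda>\<alpha>. fls_deriv (L \<alpha> $$ 1)) \<alpha>"
proof -
  have v: "vanish_below (-3) (B \<alpha>)" for \<alpha>
    by (simp add: vanish_below_def B_def plus_part_Lax_pow_3_nth)
  have B: "B \<alpha> $$ i = (if i = -3 then t_const 1 \<alpha> else if i = -1 then 3 * L \<alpha> $$ 1
     else if i = 0 then 3 * L \<alpha> $$ 2 - 3 * fls_deriv (L \<alpha> $$ 1) else 0)" for \<alpha> i
    by (simp add: B_def plus_part_Lax_pow_3_nth)
  note N = t_mult_nth[of "-3" B "-1" L, OF v vanish_below_Lax] t_mult_nth[of "-1" L "-3" B, OF vanish_below_Lax v]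
  show ?thesis
    unfolding t_commutator_def fls_minus_nth N
    by (simp add: t_mult_coeff_simps B sig_m2 sig_m3 sig_m1_1 sig_numeral sig_diff sig_uminus sig_1_1
        t_mult_comm[of "\<lambda>\<alpha>. L \<alpha> $$ 2" "\<lambda>\<alpha>. L \<alpha> $$ 1"]
        t_mult_comm[of "\<lambda>\<alpha>. fls_deriv (L \<alpha> $$ 1)" "\<lambda>\<alpha>. L \<alpha> $$ 1"])
qed

end

end

section \<open>Elimination of u_2 and u_3\<close>

lemma t_deriv_nth: "t_deriv n (\<lambda>\<alpha>. F \<alpha> $$ i) \<alpha> = t_deriv n F \<alpha> $$ i"
  by (simp add: t_deriv_def del: of_nat_add of_nat_Suc)

lemma t_deriv_fls_deriv: "t_deriv n (\<lambda>\<alpha>. fls_deriv (F \<alpha>)) \<alpha> = fls_deriv (t_deriv n F \<alpha>)"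
  by (simp add: t_deriv_def)

lemma t_deriv_diff_mult:
  fixes F G :: "'a::comm_ring_1 tseries"
  shows "t_deriv n (\<lambda>\<alpha>. F \<alpha> - c * G \<alpha>) \<alpha> = t_deriv n F \<alpha> - c * t_deriv n G \<alpha>"
  by (simp add: t_deriv_def algebra_simps)

lemma x_var_powi:
  "x_var powi (-1) = - (fls_X_inv :: 'a::field fls)"
  "x_var powi (-2) = (fls_X_inv ^ 2 :: 'a::field fls)"
  "x_var powi (-3) = - (fls_X_inv ^ 3 :: 'a::field fls)"
  by (simp_all add: x_var_def power_int_def power2_eq_square power3_eq_cube fls_inverse_X)

theorem mainTheorem5:
  fixes a :: "'a::field_char_0"
    and mul :: "'a fls fls \<Rightarrow> 'a fls fls \<Rightarrow> 'a fls fls"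
    and L :: "'a fls fls tseries"
    and u u_x u_xx u_xxx u_y u_yy u_xy u_t :: "'a fls tseries"
  assumes K: "local_skew_field a mul"
    and L: "(\<lambda>\<alpha>. L \<alpha> - t_const z_inv_K \<alpha>) \<in> tensor_series K_minus"
    and hierarchy: "KP_hierarchy mul L"
  defines "u \<equiv> (\<lambda>\<alpha>. L \<alpha> $$ 1)"
  defines "u_x \<equiv> x_deriv u" and "u_xx \<equiv> x_deriv (x_deriv u)"
    and "u_xxx \<equiv> x_deriv (x_deriv (x_deriv u))"
    and "u_y \<equiv> t_deriv 2 u" and "u_yy \<equiv> t_deriv 2 (t_deriv 2 u)"
    and "u_xy \<equiv> x_deriv (t_deriv 2 u)" and "u_t \<equiv> t_deriv 3 u"
  shows "x_deriv (\<lambda>\<alpha>. 4 * u_t \<alpha> - u_xxx \<alpha> - 12 * t_mult (*) u u_x \<alpha>)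
       = (\<lambda>\<alpha>. 3 * u_yy \<alpha>
            + 6 * fls_const a * (2 * x_var powi (-2) * u_xx \<alpha> - x_var powi (-2) * u_y \<alpha>
                - x_var powi (-1) * u_xxx \<alpha> + x_var powi (-1) * u_xy \<alpha>
                - 2 * x_var powi (-3) * u_x \<alpha>))"
proof
  fix \<alpha>
  interpret local_skew_field a mul by (rule K)
  let ?D = fls_deriv
  let ?w = "fls_X_inv :: 'a fls" and ?a = "fls_const a"
  \<comment> \<open>Every summand of the tensor lies in \<open>K_minus\<close>, so only z^(-1)
    contributes in nonpositive degrees.\<close>
  have L_nonpos: "L \<beta> $$ i = (if i = -1 then t_const 1 \<beta> else 0)" if "i \<le> 0" for i \<beta>
  proof -
    obtain r :: nat and M h where M: "\<And>j. j < r \<Longrightarrow> M j \<in> K_minus"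
      and eq: "(\<lambda>\<alpha>. L \<alpha> - t_const z_inv_K \<alpha>) = (\<lambda>\<alpha>. \<Sum>j<r. k_to_K (h j \<alpha>) * M j)"
      using L unfolding tensor_series_def by blast
    have "L \<beta> $$ i - t_const z_inv_K \<beta> $$ i = (\<Sum>j<r. k_to_K (h j \<beta>) * M j) $$ i"
      using fun_cong[OF eq, of \<beta>] by (metis fls_minus_nth)
    also have "\<dots> = 0"
      using M that by (auto simp: fls_nth_sum K_minus_def intro!: sum.neutral)
    finally show ?thesis by (auto simp: t_const_def)
  qed
  have flow: "t_deriv n (\<lambda>\<alpha>. L \<alpha> $$ i) \<beta>
      = t_commutator mul (\<lambda>\<alpha>. plus_part (t_pow mul L n \<alpha>)) L \<beta> $$ i" if "n \<ge> 1" for n i \<beta>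
    using hierarchy that unfolding KP_hierarchy_def t_deriv_nth t_plus_part_def by metis
  define u2 u3 where "u2 = (\<lambda>\<alpha>. L \<alpha> $$ 2)" and "u3 = (\<lambda>\<alpha>. L \<alpha> $$ 3)"
  define P where "P = t_mult (*) u (\<lambda>\<alpha>. ?D (u \<alpha>)) \<alpha>"
  define u2_y where "u2_y = t_deriv 2 u2"
  have uy: "u_y = (\<lambda>\<alpha>. ?D (?D (u \<alpha>)) - 2 * ?D (u2 \<alpha>))"
    unfolding u_y_def u_def u2_def by (rule ext) (simp add: flow Lax_commutator_2_nth[OF L_nonpos])
  \<comment> \<open>The formula for \<open>u_y\<close> is differentiated once more in t_2, which
    brings in \<open>u2_y\<close>.\<close>
  have uyy: "u_yy \<alpha> = ?D (?D (u_y \<alpha>)) - 2 * ?D (u2_y \<alpha>)"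
    unfolding u_yy_def u_y_def[symmetric]
    by (subst uy) (simp add: t_deriv_diff_mult t_deriv_fls_deriv u2_y_def u_y_def)
  have u2y: "u2_y \<alpha> = - ?D (- (?a * ?w * ?D (u \<alpha>))) - ?a * ?w * ?D (- ?D (u \<alpha>))
     + ?D (?D (u2 \<alpha>)) - 2 * (?a * ?w * ?D (u2 \<alpha>)) - 2 * ?D (u3 \<alpha>) - 2 * P"
    unfolding u2_y_def u2_def u3_def u_def P_def
    by (simp add: flow Lax_commutator_2_nth[OF L_nonpos] sig_m1_1 sig_m1_2)
  have ut: "u_t \<alpha> = - 3 * ?D (- (?a * ?w * ?D (u \<alpha>))) - ?D (?D (?D (u \<alpha>)))
     + 3 * ?D (?D (u2 \<alpha>)) - 3 * ?D (u3 \<alpha>) - 6 * P"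
    unfolding u_t_def u2_def u3_def u_def P_def
    by (simp add: flow Lax_commutator_3_nth[OF L_nonpos] sig_m1_1 sig_m1_2)
  have P: "t_mult (*) u u_x \<alpha> = - P"
    by (simp add: u_x_def x_deriv_def P_def t_mult_linear)
  have uxxx: "u_xxx \<alpha> = - ?D (?D (?D (u \<alpha>)))"
    by (simp add: u_xxx_def x_deriv_def)
  \<comment> \<open>Taking out 6 \<open>u2_y\<close> removes \<open>u3\<close>, since both sides
    contain -12 \<open>?D (u3 \<alpha>)\<close>, and also the quadratic term, since -24
    \<open>P\<close> + 12 \<open>P\<close> = -12 \<open>P\<close>.\<close>
  have "4 * u_t \<alpha> - u_xxx \<alpha> - 12 * t_mult (*) u u_x \<alpha>
      = 6 * u2_y \<alpha> + 6 * (?D (?a * ?w * ?D (u \<alpha>)) - ?a * ?w * ?D (?D (u \<alpha>)))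
        - 3 * ?D (?D (?D (u \<alpha>))) + 6 * ?D (?D (u2 \<alpha>)) + 12 * (?a * ?w * ?D (u2 \<alpha>))"
    unfolding P uxxx ut u2y fls_deriv_neg by (simp add: algebra_simps)
  hence "x_deriv (\<lambda>\<alpha>. 4 * u_t \<alpha> - u_xxx \<alpha> - 12 * t_mult (*) u u_x \<alpha>) \<alpha>
      = - ?D (6 * u2_y \<alpha> + 6 * (?D (?a * ?w * ?D (u \<alpha>)) - ?a * ?w * ?D (?D (u \<alpha>)))
        - 3 * ?D (?D (?D (u \<alpha>))) + 6 * ?D (?D (u2 \<alpha>)) + 12 * (?a * ?w * ?D (u2 \<alpha>)))"
    by (simp only: x_deriv_def)
  \<comment> \<open>After this derivative \<open>u2\<close> occurs only through
    \<open>?D (u2 \<alpha>)\<close>, which \<open>uy\<close> expresses by \<open>u\<close> and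
    \<open>u_y\<close>, and \<open>uyy\<close> absorbs the derivative of \<open>u2_y\<close>. The
    powers of \<open>?w\<close> arise from differentiating 1/v up to twice.\<close>
  also have "\<dots> = 3 * u_yy \<alpha>
            + 6 * ?a * (2 * ?w ^ 2 * ?D (?D (u \<alpha>)) - ?w ^ 2 * u_y \<alpha>
                - ?w * ?D (?D (?D (u \<alpha>))) + ?w * ?D (u_y \<alpha>)
                - 2 * ?w ^ 3 * ?D (u \<alpha>))"
    unfolding uyy by (simp add: uy) (simp add: algebra_simps power2_eq_square power3_eq_cube)
  \<comment> \<open>Back to x = -v: odd powers of x and odd x-derivatives each change sign.\<close>
  also have "\<dots> = 3 * u_yy \<alpha>
            + 6 * fls_const a * (2 * x_var powi (-2) * u_xx \<alpha> - x_var powi (-2) * u_y \<alpha>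
                - x_var powi (-1) * u_xxx \<alpha> + x_var powi (-1) * u_xy \<alpha>
                - 2 * x_var powi (-3) * u_x \<alpha>)"
    unfolding x_var_powi by (simp add: uxxx u_xx_def u_xy_def u_x_def u_y_def x_deriv_def)
  finally show "x_deriv (\<lambda>\<alpha>. 4 * u_t \<alpha> - u_xxx \<alpha> - 12 * t_mult (*) u u_x \<alpha>) \<alpha>
    = 3 * u_yy \<alpha>
            + 6 * fls_const a * (2 * x_var powi (-2) * u_xx \<alpha> - x_var powi (-2) * u_y \<alpha>
                - x_var powi (-1) * u_xxx \<alpha> + x_var powi (-1) * u_xy \<alpha>
                - 2 * x_var powi (-3) * u_x \<alpha>)" .
qed

end
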